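(* Let $f$ be root-like in an interval $I$, with fixed point $L$ and $f'(L)=m$. Then for every $t_0\in I$ with $t_0\neq L$, the candidate sequence $$c_n=\frac{|L-f^{(n)}(t_0)|}{m^n}$$ converges properly, i.e. $\lim_{n\to\infty}c_n$ exists, is finite, and is nonzero.
   Context: $f^{(n)}$ denotes the $n$-fold iterate of $f$ under composition ($f^{(2)}(t)=f(f(t))$, etc.). Functions are real-valued functions on a closed interval $I\subseteq\mathbb{R}$ (possibly unbounded); "smooth" means differentiable as many times as needed (twice continuously differentiable is enough here). $f$ is a contraction on $I$ if $f$ maps $I$ into $I$ and there is a constant $k<1$ with $|f'(t)|\le k$ for all $t\in I$. A smooth function $f$ is root-like in an interval $I$ when: (i) $f$ is a contraction on $I$; (ii) $f$ has a fixed point $L$ in the interior of $I$; (iii) $f'(t)>0$ and $f''(t)<0$ for all $t\in I$. Then $m:=f'(L)$ satisfies $0<m<1$. Standing assumption for root-like functions: $L>0$. For a contraction $f$ with fixed point $L$ and an initial value $t_0$, the candidate sequence is $c_n=|L-f^{(n)}(t_0)|/|f'(L)|^n$. It is said to converge properly if it has a finite nonzero limit. *)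

theory Defs
  imports "HOL-Analysis.Analysis"
begin

text \<open>
  Derivatives are taken relative to \<open>I\<close>, so they are one-sided at an endpoint of \<open>I\<close>, and the
  values of \<open>f\<close> outside \<open>I\<close> play no role. Such a derivative is unique only if \<open>I\<close> has no
  isolated points; for an interval with nonempty interior this is automatic.
\<close>

definition deriv_on :: "real set \<Rightarrow> (real \<Rightarrow> real) \<Rightarrow> real \<Rightarrow> real" where
  "deriv_on I f t = vector_derivative f (at t within I)"

text \<open>Only class \<open>C\<^sup>2\<close> is required of a ``smooth'' function.\<close>

definition C2_on :: "real set \<Rightarrow> (real \<Rightarrow> real) \<Rightarrow> bool" where
  "C2_on I f \<longleftrightarrow>
     f differentiable_on I \<and>
     deriv_on I f differentiable_on I \<and>
     continuous_on I (deriv_on I (deriv_on I f))"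

definition contraction_on :: "real set \<Rightarrow> (real \<Rightarrow> real) \<Rightarrow> bool" where
  "contraction_on I f \<longleftrightarrow>
     f ` I \<subseteq> I \<and> f differentiable_on I \<and> (\<exists>k<1. \<forall>t\<in>I. \<bar>deriv_on I f t\<bar> \<le> k)"

definition root_like :: "real set \<Rightarrow> (real \<Rightarrow> real) \<Rightarrow> bool" where
  "root_like I f \<longleftrightarrow>
     C2_on I f \<and>
     contraction_on I f \<and>
     (\<exists>L\<in>interior I. f L = L) \<and>
     (\<forall>t\<in>I. deriv_on I f t > 0 \<and> deriv_on I (deriv_on I f) t < 0)"

definition converges_properly :: "(nat \<Rightarrow> real) \<Rightarrow> bool" where
  "converges_properly c \<longleftrightarrow> (\<exists>l. l \<noteq> 0 \<and> c \<longlonglongrightarrow> l)"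

end

theory Submission
  imports Defs
begin

text \<open>
  Write \<open>x\<^sub>n\<close> for the orbit of \<open>t\<^sub>0\<close> and \<open>e\<^sub>n = x\<^sub>n - L\<close> for its error.  Along the orbit the mean value
  theorem gives \<open>e\<^sub>n\<^sub>+\<^sub>1 = f'(\<xi>\<^sub>n) e\<^sub>n\<close> with \<open>\<xi>\<^sub>n\<close> between \<open>x\<^sub>n\<close> and \<open>L\<close>, so consecutive candidates differ
  by the factor \<open>f'(\<xi>\<^sub>n) / m\<close>, and the candidate sequence is a constant times the partial products of
  these factors.  Since \<open>f'\<close> is Lipschitz on the
  bounded part of \<open>I\<close> that contains the orbit, the factor differs from \<open>1\<close> by \<open>O(\<bar>e\<^sub>n\<bar>)\<close>, and the
  contraction property makes \<open>\<bar>e\<^sub>n\<bar>\<close> decay geometrically.  The deviations from \<open>1\<close> are therefore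
  summable, and an infinite product of nonzero factors with summable deviations converges to a nonzero
  number.

  The factors are nonzero because \<open>f' > 0\<close> makes \<open>f\<close> injective, so no orbit starting away from \<open>L\<close>
  ever lands on \<open>L\<close>.  The product argument is \<open>geometric_orbit_converges_properly\<close>; the Lipschitz
  estimate enters through \<open>quadratic_remainder_on_compact\<close>.
\<close>

lemma mean_value_deriv_on:
  assumes "is_interval I" and "f differentiable_on I" and "a \<in> I" and "b \<in> I"
  obtains \<xi> where "\<xi> \<in> I" and "\<bar>\<xi> - a\<bar> \<le> \<bar>b - a\<bar>" and "f b - f a = deriv_on I f \<xi> * (b - a)"
proof -
  have ordered: "\<exists>\<xi>\<in>{u..v}. \<xi> \<in> I \<and> f v - f u = deriv_on I f \<xi> * (v - u)"
    if "u < v" "u \<in> I" "v \<in> I" for u v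
  proof -
    have sub: "{u..v} \<subseteq> I"
      using mem_is_interval_1_I[OF assms(1) that(2,3)] by auto
    have "(f has_derivative (\<lambda>h. h *\<^sub>R deriv_on I f x)) (at x within {u..v})"
      if "u \<le> x" "x \<le> v" for x
    proof -
      have "x \<in> I" using sub that by auto
      then have "f differentiable (at x within I)"
        using assms(2) by (simp add: differentiable_on_def)
      then have "(f has_vector_derivative deriv_on I f x) (at x within I)"
        unfolding deriv_on_def by (simp add: vector_derivative_works)
      then show ?thesis
        unfolding has_vector_derivative_def using sub by (rule has_derivative_subset)
    qed
    then obtain \<xi> where "\<xi> \<in> {u<..<v}" "f v - f u = (v - u) *\<^sub>R deriv_on I f \<xi>"
      using mvt_simple[OF \<open>u < v\<close>, of f "\<lambda>x h. h *\<^sub>R deriv_on I f x"] by auto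
    then show ?thesis using sub by (intro bexI[of _ \<xi>]) (auto simp: mult.commute)
  qed
  consider "a < b" | "b < a" | "a = b" by linarith
  then show thesis
  proof cases
    case 1
    then obtain \<xi> where "\<xi> \<in> {a..b}" "\<xi> \<in> I" "f b - f a = deriv_on I f \<xi> * (b - a)"
      using ordered[of a b] assms(3,4) by blast
    then show ?thesis by (intro that[of \<xi>]) auto
  next
    case 2
    then obtain \<xi> where "\<xi> \<in> {b..a}" "\<xi> \<in> I" "f a - f b = deriv_on I f \<xi> * (a - b)"
      using ordered[of b a] assms(3,4) by blast
    then show ?thesis by (intro that[of \<xi>]) (auto simp: algebra_simps)
  next
    case 3
    then show ?thesis using that[of a] assms(3) by simp
  qed
qed

text \<open>
  The mean value theorem for \<open>f\<close> turns the remainder into \<open>(f'(\<xi>) - f'(L)) (t - L)\<close> with \<open>\<xi>\<close>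
  between \<open>L\<close> and \<open>t\<close>, and applied to \<open>f'\<close> it bounds the first factor by \<open>sup \<bar>f''\<bar> \<bar>\<xi> - L\<bar>\<close>.
  Since \<open>f''\<close> may be unbounded on an unbounded \<open>I\<close>, the estimate is confined to a ball
  around \<open>L\<close>, whose intersection with the closed set \<open>I\<close> is compact.
\<close>

lemma quadratic_remainder_on_compact:
  assumes "is_interval I" and "closed I" and "C2_on I f" and "L \<in> I"
  obtains C where "\<And>t. t \<in> I \<Longrightarrow> \<bar>t - L\<bar> \<le> r \<Longrightarrow>
    \<bar>f t - f L - deriv_on I f L * (t - L)\<bar> \<le> C * \<bar>t - L\<bar>\<^sup>2"
proof -
  let ?K = "I \<inter> cball L r"
  have diff: "f differentiable_on I" "deriv_on I f differentiable_on I"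
    and cont: "continuous_on I (deriv_on I (deriv_on I f))"
    using assms(3) by (auto simp: C2_on_def)
  have "compact ?K"
    using assms(2) by (simp add: closed_Int_compact)
  then have "bounded (deriv_on I (deriv_on I f) ` ?K)"
    using cont by (intro compact_imp_bounded compact_continuous_image)
      (auto intro: continuous_on_subset)
  then obtain C where "\<forall>s\<in>?K. \<bar>deriv_on I (deriv_on I f) s\<bar> \<le> C"
    unfolding bounded_iff by auto
  then have C: "\<bar>deriv_on I (deriv_on I f) s\<bar> \<le> C" if "s \<in> ?K" for s
    using that by (rule bspec)
  show thesis
  proof (rule that[of C])
    fix t assume t: "t \<in> I" "\<bar>t - L\<bar> \<le> r"
    obtain \<xi> where \<xi>: "\<xi> \<in> I" "\<bar>\<xi> - L\<bar> \<le> \<bar>t - L\<bar>" "f t - f L = deriv_on I f \<xi> * (t - L)"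
      using mean_value_deriv_on[OF assms(1) diff(1) assms(4) t(1)] by blast
    obtain \<eta> where \<eta>: "\<eta> \<in> I" "\<bar>\<eta> - L\<bar> \<le> \<bar>\<xi> - L\<bar>"
      "deriv_on I f \<xi> - deriv_on I f L = deriv_on I (deriv_on I f) \<eta> * (\<xi> - L)"
      using mean_value_deriv_on[OF assms(1) diff(2) assms(4) \<xi>(1)] by blast
    have "\<eta> \<in> ?K" using \<eta> \<xi> t by (auto simp: dist_real_def abs_minus_commute)
    then have "\<bar>deriv_on I (deriv_on I f) \<eta>\<bar> \<le> C" by (rule C)
    then have "\<bar>deriv_on I f \<xi> - deriv_on I f L\<bar> \<le> C * \<bar>t - L\<bar>"
      unfolding \<eta>(3) abs_mult using \<xi>(2) by (intro mult_mono) auto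
    then have "\<bar>deriv_on I f \<xi> - deriv_on I f L\<bar> * \<bar>t - L\<bar> \<le> C * \<bar>t - L\<bar> * \<bar>t - L\<bar>"
      by (intro mult_right_mono) auto
    moreover have "f t - f L - deriv_on I f L * (t - L) = (deriv_on I f \<xi> - deriv_on I f L) * (t - L)"
      using \<xi>(3) by (simp add: algebra_simps)
    ultimately show "\<bar>f t - f L - deriv_on I f L * (t - L)\<bar> \<le> C * \<bar>t - L\<bar>\<^sup>2"
      by (simp only: abs_mult) (simp add: power2_eq_square mult.assoc)
  qed
qed

text \<open>
  A sequence that approaches \<open>L\<close> geometrically, with error multiplied by \<open>m\<close> at each step up to a
  quadratic term, has rate exactly \<open>m\<^sup>n\<close>: the normalised error telescopes into a product of the
  ratios \<open>q n\<close> below, and the quadratic term bounds \<open>\<bar>q n - 1\<bar>\<close> by a geometric sequence.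
\<close>

lemma geometric_orbit_converges_properly:
  fixes x :: "nat \<Rightarrow> real"
  assumes "m > 0" and "0 \<le> k" and "k < 1"
    and nz: "\<And>n. x n \<noteq> L"
    and decay: "\<And>n. \<bar>x n - L\<bar> \<le> D * k ^ n"
    and quad: "\<And>n. \<bar>x (Suc n) - L - m * (x n - L)\<bar> \<le> C * \<bar>x n - L\<bar>\<^sup>2"
  shows "converges_properly (\<lambda>n. \<bar>L - x n\<bar> / m ^ n)"
proof -
  define q where "q n = (x (Suc n) - L) / (m * (x n - L))" for n
  have q_nz: "q n \<noteq> 0" for n
    using nz assms(1) by (simp add: q_def)
  have bound: "\<bar>q n - 1\<bar> \<le> \<bar>C\<bar> * D / m * k ^ n" for n
  proof -
    let ?e = "\<bar>x n - L\<bar>"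
    have e: "?e > 0" using nz by simp
    have "\<bar>q n - 1\<bar> = \<bar>x (Suc n) - L - m * (x n - L)\<bar> / (m * ?e)"
    proof -
      have "q n - 1 = (x (Suc n) - L - m * (x n - L)) / (m * (x n - L))"
        using nz[of n] assms(1) by (simp add: q_def diff_divide_distrib)
      then show ?thesis using assms(1) by (simp add: abs_mult)
    qed
    also have "\<dots> \<le> C * ?e\<^sup>2 / (m * ?e)"
      using quad[of n] assms(1) by (intro divide_right_mono) auto
    also have "\<dots> = C / m * ?e"
      using e assms(1) by (simp add: power2_eq_square field_simps)
    also have "\<dots> \<le> \<bar>C\<bar> / m * (D * k ^ n)"
      using decay[of n] assms(1) by (intro mult_mono divide_right_mono) auto
    finally show ?thesis by (simp add: algebra_simps)
  qed
  have "summable (\<lambda>n. \<bar>C\<bar> * D / m * k ^ n)"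
    using assms(2,3) by (intro summable_mult summable_geometric) simp
  then have "summable (\<lambda>n. norm (q n - 1))"
    by (rule summable_comparison_test') (use bound in simp)
  then have conv: "convergent_prod q"
    by (intro abs_convergent_prod_imp_convergent_prod)
      (simp add: abs_convergent_prod_conv_summable)
  have telescope: "\<bar>L - x n\<bar> / m ^ n = \<bar>x 0 - L\<bar> * \<bar>\<Prod>i<n. q i\<bar>" for n
  proof (induction n)
    case (Suc n)
    have "\<bar>q n\<bar> = \<bar>L - x (Suc n)\<bar> / (m * \<bar>L - x n\<bar>)"
      using assms(1) by (simp add: q_def abs_mult abs_minus_commute[of L])
    moreover have "\<bar>L - x n\<bar> > 0" using nz[of n] by simp
    ultimately have "\<bar>L - x (Suc n)\<bar> / m ^ Suc n = (\<bar>L - x n\<bar> / m ^ n) * \<bar>q n\<bar>"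
      by simp
    then show ?case using Suc.IH by (simp add: abs_mult)
  qed (simp add: abs_minus_commute)
  have "(\<lambda>n. \<Prod>i<n. q i) \<longlonglongrightarrow> prodinf q"
  proof -
    have "(\<lambda>n. \<Prod>i<Suc n. q i) \<longlonglongrightarrow> prodinf q"
      using convergent_prod_LIMSEQ[OF conv] by (simp add: lessThan_Suc_atMost)
    then show ?thesis by (rule LIMSEQ_imp_Suc)
  qed
  then have "(\<lambda>n. \<bar>L - x n\<bar> / m ^ n) \<longlonglongrightarrow> \<bar>x 0 - L\<bar> * \<bar>prodinf q\<bar>"
    unfolding telescope by (intro tendsto_intros)
  moreover have "prodinf q \<noteq> 0"
    using conv q_nz by (rule prodinf_nonzero)
  ultimately show ?thesis
    unfolding converges_properly_def using nz[of 0] by (intro exI conjI) auto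
qed

theorem theorem2p1:
  fixes I :: "real set" and f :: "real \<Rightarrow> real" and L m t\<^sub>0 :: real
  assumes "is_interval I" and "closed I"
    and "root_like I f"
    and "L \<in> I" and "f L = L" and "L > 0"
    and "m = deriv_on I f L"
    and "t\<^sub>0 \<in> I" and "t\<^sub>0 \<noteq> L"
  shows "converges_properly (\<lambda>n. \<bar>L - (f ^^ n) t\<^sub>0\<bar> / m ^ n)"
proof -
  have C2: "C2_on I f" and pos: "\<And>t. t \<in> I \<Longrightarrow> deriv_on I f t > 0"
    and maps: "f ` I \<subseteq> I" and diff: "f differentiable_on I"
    using assms(3) by (auto simp: root_like_def contraction_on_def)
  obtain k where k: "k < 1" "\<And>t. t \<in> I \<Longrightarrow> \<bar>deriv_on I f t\<bar> \<le> k"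
    using assms(3) by (auto simp: root_like_def contraction_on_def)
  have k0: "0 \<le> k" using k(2)[OF assms(4)] by linarith
  have step: "f t \<in> I \<and> \<bar>f t - L\<bar> \<le> k * \<bar>t - L\<bar> \<and> (t \<noteq> L \<longrightarrow> f t \<noteq> L)" if t: "t \<in> I" for t
  proof -
    obtain \<xi> where \<xi>: "\<xi> \<in> I" "f t - f L = deriv_on I f \<xi> * (t - L)"
      using mean_value_deriv_on[OF assms(1) diff assms(4) t] by blast
    have eq: "f t - L = deriv_on I f \<xi> * (t - L)"
      using \<xi>(2) assms(5) by simp
    have "\<bar>f t - L\<bar> \<le> k * \<bar>t - L\<bar>"
      unfolding eq abs_mult using k(2)[OF \<xi>(1)] by (intro mult_right_mono) auto
    moreover have "f t \<noteq> L" if "t \<noteq> L"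
      using eq pos[OF \<xi>(1)] that by auto
    ultimately show ?thesis using maps t by auto
  qed
  define x where "x n = (f ^^ n) t\<^sub>0" for n
  have xS: "x (Suc n) = f (x n)" for n by (simp add: x_def)
  have orbit: "x n \<in> I \<and> x n \<noteq> L \<and> \<bar>x n - L\<bar> \<le> \<bar>t\<^sub>0 - L\<bar> * k ^ n" for n
  proof (induction n)
    case 0
    then show ?case using assms(8,9) by (simp add: x_def)
  next
    case (Suc n)
    have succ: "x (Suc n) \<in> I" "x (Suc n) \<noteq> L" "\<bar>x (Suc n) - L\<bar> \<le> k * \<bar>x n - L\<bar>"
      using step[of "x n"] Suc by (simp_all add: xS)
    note succ(3)
    also have "\<dots> \<le> k * (\<bar>t\<^sub>0 - L\<bar> * k ^ n)"
      using Suc k0 by (intro mult_left_mono) auto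
    finally show ?case using succ(1,2) by (simp add: algebra_simps)
  qed
  have near: "\<bar>x n - L\<bar> \<le> \<bar>t\<^sub>0 - L\<bar>" for n
  proof -
    have "k ^ n \<le> 1" using k0 k(1) by (simp add: power_le_one)
    then have "\<bar>t\<^sub>0 - L\<bar> * k ^ n \<le> \<bar>t\<^sub>0 - L\<bar>"
      by (intro mult_left_le) auto
    then show ?thesis using orbit[of n] by linarith
  qed
  obtain C where C: "\<bar>f t - f L - m * (t - L)\<bar> \<le> C * \<bar>t - L\<bar>\<^sup>2"
    if "t \<in> I" "\<bar>t - L\<bar> \<le> \<bar>t\<^sub>0 - L\<bar>" for t
    using quadratic_remainder_on_compact[OF assms(1,2) C2 assms(4)] assms(7) by metis
  have "converges_properly (\<lambda>n. \<bar>L - x n\<bar> / m ^ n)"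
  proof (rule geometric_orbit_converges_properly)
    show "m > 0" using pos assms(4,7) by simp
    show "0 \<le> k" "k < 1" using k0 k(1) by auto
    show "x n \<noteq> L" "\<bar>x n - L\<bar> \<le> \<bar>t\<^sub>0 - L\<bar> * k ^ n" for n
      using orbit[of n] by auto
    show "\<bar>x (Suc n) - L - m * (x n - L)\<bar> \<le> C * \<bar>x n - L\<bar>\<^sup>2" for n
      using C[of "x n"] orbit[of n] near[of n] assms(5) xS by simp
  qed
  then show ?thesis by (simp add: x_def)
qed

end
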